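(* There is a constant $C \geq 0$ such that for all integers $0 \leq k \leq n$ we have \[ \frac{n!}{(n-k)!} \leq f_{k}(n) \leq \frac{n!}{(n-k)!} \cdot 2^{k + C k^{2/3}}. \]
   Context: Let $S_n$ denote the set of permutations of $\{1,\ldots,n\}$, written in one-line notation as strings $\sigma(1)\sigma(2)\cdots\sigma(n)$. For $\sigma \in S_n$ and $A \subseteq \{1,\ldots,n\}$, $\sigma - A$ denotes the string obtained from $\sigma$ by deleting all symbols in $A$ (and contracting). The Ulam distance is $d_U(\alpha,\beta) = \min\{|A| : \alpha - A = \beta - A\}$ for $\alpha,\beta \in S_n$. For integers $k \ge 0$ and $n \ge 1$, $f_k(n)$ denotes the maximum size of a set $\mathcal{F} \subseteq S_n$ such that $d_U(\alpha,\beta) \leq k$ for all $\alpha,\beta \in \mathcal{F}$. *)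

theory Defs
  imports Complex_Main "HOL-Combinatorics.Multiset_Permutations"
begin

text \<open>A permutation of \<open>{1..n}\<close> in one-line notation is a duplicate-free list
  with set of entries \<open>{1..n}\<close>, i.e. an element of \<open>permutations_of_set {1..n}\<close>.\<close>

abbreviation perm_strings :: "nat \<Rightarrow> nat list set" where
  "perm_strings n \<equiv> permutations_of_set {1..n}"

definition delete_symbols :: "'a list \<Rightarrow> 'a set \<Rightarrow> 'a list" where
  "delete_symbols \<sigma> A = filter (\<lambda>x. x \<notin> A) \<sigma>"

definition ulam_dist :: "nat \<Rightarrow> nat list \<Rightarrow> nat list \<Rightarrow> nat" where
  "ulam_dist n \<alpha> \<beta> =
     Min {card A | A. A \<subseteq> {1..n} \<and> delete_symbols \<alpha> A = delete_symbols \<beta> A}"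

definition ulam_bounded_families :: "nat \<Rightarrow> nat \<Rightarrow> nat list set set" where
  "ulam_bounded_families k n =
     {F. F \<subseteq> perm_strings n \<and> (\<forall>\<alpha>\<in>F. \<forall>\<beta>\<in>F. ulam_dist n \<alpha> \<beta> \<le> k)}"

definition max_ulam_family :: "nat \<Rightarrow> nat \<Rightarrow> nat" where
  "max_ulam_family k n = Max (card ` ulam_bounded_families k n)"

text \<open>The sets under \<open>Min\<close> and \<open>Max\<close> are finite and nonempty, so both extrema are attained.\<close>

lemma ulam_dist_attained:
  assumes "\<alpha> \<in> perm_strings n" "\<beta> \<in> perm_strings n"
  shows "\<exists>A\<subseteq>{1..n}. delete_symbols \<alpha> A = delete_symbols \<beta> A \<and> card A = ulam_dist n \<alpha> \<beta>"
proof -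
  let ?S = "{card A | A. A \<subseteq> {1..n} \<and> delete_symbols \<alpha> A = delete_symbols \<beta> A}"
  have "?S \<subseteq> card ` Pow {1..n}" by blast
  hence "finite ?S" by (rule finite_subset) (intro finite_imageI finite_Pow_iff[THEN iffD2] finite_atLeastAtMost)
  moreover have "delete_symbols \<gamma> {1..n} = []" if "\<gamma> \<in> perm_strings n" for \<gamma>
    using permutations_of_setD(1)[OF that] by (auto simp: delete_symbols_def filter_empty_conv)
  hence "delete_symbols \<alpha> {1..n} = delete_symbols \<beta> {1..n}" using assms by metis
  hence "?S \<noteq> {}" by blast
  ultimately have "Min ?S \<in> ?S" by (rule Min_in)
  hence "ulam_dist n \<alpha> \<beta> \<in> ?S" by (simp only: ulam_dist_def)
  then obtain A where "ulam_dist n \<alpha> \<beta> = card A" "A \<subseteq> {1..n}"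
    "delete_symbols \<alpha> A = delete_symbols \<beta> A"
    unfolding mem_Collect_eq by (elim exE conjE)
  thus ?thesis by (intro exI[of _ A] conjI) simp_all
qed

lemma max_ulam_family_attained:
  "\<exists>F\<in>ulam_bounded_families k n. card F = max_ulam_family k n"
proof -
  have "finite (ulam_bounded_families k n)"
    by (rule finite_subset[of _ "Pow (perm_strings n)"]) (auto simp: ulam_bounded_families_def)
  moreover have "{} \<in> ulam_bounded_families k n" by (simp add: ulam_bounded_families_def)
  ultimately have "max_ulam_family k n \<in> card ` ulam_bounded_families k n"
    unfolding max_ulam_family_def by (intro Max_in finite_imageI) blast+
  thus ?thesis by (metis imageE)
qed

end

theory Submission
  imports Defs
begin

text \<open>Lower bound: deleting a fixed \<open>k\<close>-set of symbols maps the \<open>n!\<close> permutations onto \<open>(n-k)!\<close>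
  strings, and each fibre has diameter at most \<open>k\<close>.

  Upper bound: we may assume that \<open>k\<close> is the exact diameter of the family, attained by \<open>\<alpha>\<close> and \<open>\<beta>\<close>.
  For \<open>\<sigma>\<close> in the family choose \<open>k\<close>-sets \<open>A\<close> and \<open>B\<close> with \<open>\<sigma> - A = \<alpha> - A\<close> and \<open>\<sigma> - B = \<beta> - B\<close>, and write
  \<open>|A \<union> B| = k + w\<close>. Then \<open>\<alpha> - (A \<union> B) = \<beta> - (A \<union> B)\<close>, which leaves only \<open>2^k (n+w choose w)\<close> choices
  for \<open>A \<union> B\<close>. Given \<open>A\<close> and \<open>B\<close>, \<open>\<sigma> - (A \<inter> B)\<close> is determined up to a shuffle of the symbols of
  \<open>A - B\<close> with those of \<open>B - A\<close>, and the \<open>k - w\<close> symbols of \<open>A \<inter> B\<close> are then inserted freely. If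
  \<open>n - k\<close> exceeds \<open>k/8\<close>, the \<open>w\<close> lost insertions save about \<open>n^w\<close>, which cancels the freedom in
  \<open>A \<union> B\<close>; what remains is \<open>2^k\<close> times the sum of \<open>(c k^2)^w / w!^3\<close>, which is \<open>exp (O(k^(2/3)))\<close>. For
  smaller \<open>n - k\<close>, the trivial bound \<open>(n choose k) n!/(n-k)!\<close> on a ball suffices.\<close>

section \<open>Deletions and restrictions to pairs of symbols\<close>

text \<open>Induction on the first string. The choice \<open>u = v = x\<close> shows that
  \<open>ys\<close> is nonempty. The pair of the two heads keeps both heads in first place, so they
  agree and can be stripped from every restriction.\<close>

lemma list_eq_if_pair_filters_eq:
  assumes "\<And>u v. filter (\<lambda>x. x = u \<or> x = v) xs = filter (\<lambda>x. x = u \<or> x = v) ys"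
  shows "xs = ys"
  using assms
proof (induction xs arbitrary: ys)
  case Nil
  show ?case
  proof (cases ys)
    case (Cons y ys')
    then show ?thesis using Nil[of y y] by simp
  qed simp
next
  case (Cons x xs)
  obtain y ys' where ys: "ys = y # ys'"
    using Cons.prems[of x x] by (cases ys) auto
  have "x = y"
    using Cons.prems[of x y] by (simp add: ys)
  moreover have "filter (\<lambda>z. z = u \<or> z = v) xs = filter (\<lambda>z. z = u \<or> z = v) ys'" for u v
    using Cons.prems[of u v] \<open>x = y\<close> by (auto simp: ys split: if_splits)
  ultimately show ?case using Cons.IH[of ys'] by (simp add: ys)
qed

text \<open>This reads equality after deletion as a covering condition: \<open>T\<close> must meet
  every pair on which the two strings disagree. Monotonicity in \<open>T\<close> and the counting of
  covers both rest on this form.\<close>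

lemma delete_symbols_eq_iff_pairs:
  "delete_symbols \<alpha> T = delete_symbols \<beta> T \<longleftrightarrow>
    (\<forall>u v. u \<notin> T \<longrightarrow> v \<notin> T \<longrightarrow>
      filter (\<lambda>x. x = u \<or> x = v) \<alpha> = filter (\<lambda>x. x = u \<or> x = v) \<beta>)" (is "?L \<longleftrightarrow> ?R")
proof
  assume L: ?L
  show ?R
  proof (intro allI impI)
    fix u v assume "u \<notin> T" "v \<notin> T"
    then have "filter (\<lambda>x. x = u \<or> x = v) \<gamma> = filter (\<lambda>x. x = u \<or> x = v) (delete_symbols \<gamma> T)" for \<gamma>
      by (auto simp: delete_symbols_def intro!: filter_cong)
    with L show "filter (\<lambda>x. x = u \<or> x = v) \<alpha> = filter (\<lambda>x. x = u \<or> x = v) \<beta>" by metis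
  qed
next
  assume R: ?R
  show ?L
  proof (rule list_eq_if_pair_filters_eq)
    fix u v
    define P where "P = (\<lambda>x. (x = u \<or> x = v) \<and> x \<notin> T)"
    \<comment> \<open>If just one of \<open>u\<close> and \<open>v\<close> survives outside
      \<open>T\<close>, it serves as both \<open>u'\<close> and \<open>v'\<close>.\<close>
    have "P = (\<lambda>x. False) \<or> (\<exists>u' v'. u' \<notin> T \<and> v' \<notin> T \<and> P = (\<lambda>x. x = u' \<or> x = v'))"
      by (cases "u \<in> T"; cases "v \<in> T") (fastforce simp: P_def fun_eq_iff)+
    then have "filter P \<alpha> = filter P \<beta>" using R by auto
    then show "filter (\<lambda>x. x = u \<or> x = v) (delete_symbols \<alpha> T)
        = filter (\<lambda>x. x = u \<or> x = v) (delete_symbols \<beta> T)"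
      by (simp add: delete_symbols_def P_def conj_commute)
  qed
qed

lemma delete_symbols_mono:
  assumes "delete_symbols \<alpha> A = delete_symbols \<beta> A" "A \<subseteq> B"
  shows "delete_symbols \<alpha> B = delete_symbols \<beta> B"
  using assms unfolding delete_symbols_eq_iff_pairs by blast

lemma delete_symbols_permutations:
  assumes "\<sigma> \<in> permutations_of_set S"
  shows "delete_symbols \<sigma> A \<in> permutations_of_set (S - A)"
  using assms by (auto simp: permutations_of_set_def delete_symbols_def)

section \<open>Sizes of the fibres of the deletion map\<close>

definition perm_fibre :: "'a set \<Rightarrow> 'a set \<Rightarrow> 'a list \<Rightarrow> 'a list set" where
  "perm_fibre S A L = {\<sigma> \<in> permutations_of_set S. delete_symbols \<sigma> A = L}"

lemma finite_perm_fibre [simp]: "finite (perm_fibre S A L)"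
  by (simp add: perm_fibre_def)

text \<open>A permutation is recovered from the position of \<open>a\<close> and the string without
  \<open>a\<close>; there are \<open>card S\<close> positions.\<close>

lemma card_perm_fibre_insert:
  assumes "finite S" "a \<in> S" "a \<notin> A"
  shows "card (perm_fibre S (insert a A) L) \<le> card S * card (perm_fibre (S - {a}) A L)"
proof -
  let ?g = "\<lambda>\<sigma>. (length (takeWhile (\<lambda>x. x \<noteq> a) \<sigma>), filter (\<lambda>x. x \<noteq> a) \<sigma>)"
  have split: "take (length (takeWhile (\<lambda>x. x \<noteq> a) \<sigma>)) (filter (\<lambda>x. x \<noteq> a) \<sigma>) @ a #
      drop (length (takeWhile (\<lambda>x. x \<noteq> a) \<sigma>)) (filter (\<lambda>x. x \<noteq> a) \<sigma>) = \<sigma>"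
    and less: "length (takeWhile (\<lambda>x. x \<noteq> a) \<sigma>) < card S"
    if "\<sigma> \<in> perm_fibre S (insert a A) L" for \<sigma>
  proof -
    have d: "distinct \<sigma>" "set \<sigma> = S"
      using that by (auto simp: perm_fibre_def permutations_of_set_def)
    then obtain xs ys where s: "\<sigma> = xs @ a # ys" using assms(2) by (metis split_list)
    have notin: "a \<notin> set xs" "a \<notin> set ys" using d s by auto
    then have tw: "takeWhile (\<lambda>x. x \<noteq> a) \<sigma> = xs"
      unfolding s by (subst takeWhile_append2) auto
    have "filter (\<lambda>x. x \<noteq> a) xs = xs" "filter (\<lambda>x. x \<noteq> a) ys = ys"
      using notin by (auto simp: filter_id_conv)
    then show "take (length (takeWhile (\<lambda>x. x \<noteq> a) \<sigma>)) (filter (\<lambda>x. x \<noteq> a) \<sigma>) @ a #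
      drop (length (takeWhile (\<lambda>x. x \<noteq> a) \<sigma>)) (filter (\<lambda>x. x \<noteq> a) \<sigma>) = \<sigma>"
      unfolding tw by (simp add: s)
    show "length (takeWhile (\<lambda>x. x \<noteq> a) \<sigma>) < card S"
      unfolding tw using distinct_card[OF d(1)] d(2) s by simp
  qed
  have "inj_on ?g (perm_fibre S (insert a A) L)"
    by (rule inj_onI) (metis split prod.inject)
  moreover have "?g ` perm_fibre S (insert a A) L \<subseteq> {..<card S} \<times> perm_fibre (S - {a}) A L"
    using less by (force simp: perm_fibre_def permutations_of_set_def delete_symbols_def conj_commute
        intro: filter_cong)
  ultimately have "card (perm_fibre S (insert a A) L) \<le> card ({..<card S} \<times> perm_fibre (S - {a}) A L)"
    by (intro card_inj_on_le) auto
  then show ?thesis by simp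
qed

text \<open>Reinserting the symbols of \<open>A\<close> one at a time multiplies the falling factors
  \<open>card S\<close>, \<open>card S - 1\<close>, and so on. The product form avoids division in
  the naturals.\<close>

lemma card_perm_fibre_le:
  assumes "finite S" "A \<subseteq> S"
  shows "card (perm_fibre S A L) * fact (card S - card A) \<le> fact (card S)"
proof -
  have "finite A" using assms finite_subset by blast
  then show ?thesis using assms
  proof (induction A arbitrary: S rule: finite_induct)
    case empty
    have "card (perm_fibre S {} L) \<le> card {L}"
      by (intro card_mono) (auto simp: perm_fibre_def delete_symbols_def)
    then show ?case by simp
  next
    case (insert a A)
    have pos: "card S > 0" using insert.prems by (auto simp: card_gt_0_iff)
    have c: "card (S - {a}) = card S - 1" using insert.prems by simp
    have "card (perm_fibre S (insert a A) L) * fact (card S - card (insert a A))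
      \<le> card S * (card (perm_fibre (S - {a}) A L) * fact (card (S - {a}) - card A))"
      using mult_right_mono[OF card_perm_fibre_insert[of S a A L],
          of "fact (card S - card (insert a A))"] insert c
      by (simp add: mult.assoc)
    also have "\<dots> \<le> card S * fact (card (S - {a}))"
      using insert by (intro mult_left_mono insert.IH) auto
    also have "\<dots> = fact (card S)" using pos c by (simp add: fact_reduce)
    finally show ?case .
  qed
qed

lemma card_perm_fibre_le_real:
  assumes "finite S" "A \<subseteq> S"
  shows "real (card (perm_fibre S A L)) \<le> fact (card S) / fact (card S - card A)"
proof -
  have "real (card (perm_fibre S A L) * fact (card S - card A)) \<le> real (fact (card S))"
    using card_perm_fibre_le[OF assms] by (simp only: of_nat_le_iff)
  then show ?thesis by (simp add: pos_le_divide_eq)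
qed

section \<open>Permutations with two prescribed deletions\<close>

lemma card_le_card_index_times:
  assumes "finite I" "\<And>i. i \<in> I \<Longrightarrow> finite (G i)" "X \<subseteq> (\<Union>i\<in>I. G i)"
    and "\<And>i. i \<in> I \<Longrightarrow> real (card (G i)) \<le> b"
  shows "real (card X) \<le> real (card I) * b"
proof -
  have "card X \<le> card (\<Union>i\<in>I. G i)" using assms by (intro card_mono finite_UN_I) auto
  also have "\<dots> \<le> (\<Sum>i\<in>I. card (G i))" using assms(1) by (rule card_UN_le)
  finally have "real (card X) \<le> (\<Sum>i\<in>I. real (card (G i)))"
    unfolding of_nat_sum[symmetric] of_nat_le_iff .
  also have "\<dots> \<le> real (card I) * b" using assms(4) by (rule sum_bounded_above)
  finally show ?thesis .
qed

lemma card_le_card_image_times: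
  assumes "finite X" "\<And>y. y \<in> f ` X \<Longrightarrow> real (card {x \<in> X. f x = y}) \<le> b"
    and "real (card (f ` X)) \<le> a" "0 \<le> b"
  shows "real (card X) \<le> a * b"
proof -
  have "real (card X) \<le> real (card (f ` X)) * b"
    using assms by (intro card_le_card_index_times[where G = "\<lambda>y. {x \<in> X. f x = y}"]) auto
  also have "\<dots> \<le> a * b" using assms by (intro mult_right_mono)
  finally show ?thesis .
qed

text \<open>Factor through the deletion of \<open>A \<inter> B\<close>. Its fibres are bounded by
  free insertion of \<open>k - w\<close> symbols, and its image by the number of shuffles of two
  words of length \<open>w\<close>.\<close>

lemma card_two_fibres_le:
  assumes "finite S" "A \<subseteq> S" "B \<subseteq> S" "card A = k" "card B = k" "card (A \<union> B) = k + w"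
  shows "real (card (perm_fibre S A L \<inter> perm_fibre S B M))
    \<le> 4 ^ w * (fact (card S) / fact (card S - (k - w)))"
proof (rule card_le_card_image_times[where f = "\<lambda>\<sigma>. delete_symbols \<sigma> (A \<inter> B)"])
  let ?X = "perm_fibre S A L \<inter> perm_fibre S B M"
  let ?D = "\<lambda>\<sigma>. delete_symbols \<sigma> (A \<inter> B)"
  have fin: "finite A" "finite B" using assms finite_subset by blast+
  have cI: "card (A \<inter> B) = k - w" using card_Un_Int[OF fin] assms by simp
  have cA: "card (A - B) = w" and cB: "card (B - A) = w"
    using assms fin card_Un_disjoint[of A "B - A"] card_Un_disjoint[of B "A - B"]
    by (auto simp: Un_commute)
  show "finite ?X" by simp
  show "0 \<le> (fact (card S) / fact (card S - (k - w)) :: real)" by simp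
  show "real (card {\<sigma> \<in> ?X. ?D \<sigma> = \<rho>}) \<le> fact (card S) / fact (card S - (k - w))" for \<rho>
  proof -
    have "card {\<sigma> \<in> ?X. ?D \<sigma> = \<rho>} \<le> card (perm_fibre S (A \<inter> B) \<rho>)"
      by (intro card_mono) (auto simp: perm_fibre_def)
    also have "real \<dots> \<le> fact (card S) / fact (card S - card (A \<inter> B))"
      using assms by (intro card_perm_fibre_le_real) auto
    finally show ?thesis by (simp add: cI)
  qed
  let ?f = "\<lambda>\<rho>. filter (\<lambda>x. x \<in> A \<or> x \<in> B) \<rho>"
  \<comment> \<open>The roles cross: the symbols of \<open>A - B\<close> survive the deletion of
    \<open>B\<close>, so their order is read off from \<open>M\<close>, and that of
    \<open>B - A\<close> from \<open>L\<close>.\<close>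
  let ?LA = "filter (\<lambda>x. x \<in> A) M" and ?LB = "filter (\<lambda>x. x \<in> B) L"
  \<comment> \<open>A pair avoiding \<open>A\<close> or avoiding \<open>B\<close> is already ordered
    by \<open>L\<close> or \<open>M\<close>. Any other pair outside \<open>A \<inter> B\<close> has
    one symbol in \<open>A - B\<close> and one in \<open>B - A\<close>, so \<open>?f\<close> records
    its order.\<close>
  have inj: "inj_on ?f (?D ` ?X)"
  proof (rule inj_onI, elim imageE, hypsubst)
    fix \<sigma> \<tau> assume st: "\<sigma> \<in> ?X" "\<tau> \<in> ?X" and eq: "?f (?D \<sigma>) = ?f (?D \<tau>)"
    let ?p = "\<lambda>u v xs. filter (\<lambda>x. x = u \<or> x = v) xs"
    have "delete_symbols \<sigma> A = delete_symbols \<tau> A" "delete_symbols \<sigma> B = delete_symbols \<tau> B"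
      using st by (auto simp: perm_fibre_def)
    then have A: "?p u v \<sigma> = ?p u v \<tau>" if "u \<notin> A \<and> v \<notin> A \<or> u \<notin> B \<and> v \<notin> B" for u v
      using that unfolding delete_symbols_eq_iff_pairs by blast
    have AB: "?p u v \<sigma> = ?p u v \<tau>" if "u \<in> A \<union> B" "v \<in> A \<union> B" "u \<notin> A \<inter> B" "v \<notin> A \<inter> B" for u v
    proof -
      have "?p u v \<pi> = ?p u v (?f (?D \<pi>))" for \<pi>
        using that by (auto simp: delete_symbols_def intro!: filter_cong)
      then show ?thesis using eq by metis
    qed
    show "?D \<sigma> = ?D \<tau>"
      unfolding delete_symbols_eq_iff_pairs using A AB by blast
  qed
  have sub: "?f ` ?D ` ?X \<subseteq> shuffles ?LA ?LB"
  proof (clarify)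
    fix \<sigma> assume s: "\<sigma> \<in> perm_fibre S A L" "\<sigma> \<in> perm_fibre S B M"
    let ?r = "?f (?D \<sigma>)"
    have "M = filter (\<lambda>x. x \<notin> B) \<sigma>" "L = filter (\<lambda>x. x \<notin> A) \<sigma>"
      using s by (auto simp: perm_fibre_def delete_symbols_def)
    then have "filter (\<lambda>x. x \<in> A) ?r = ?LA" "filter (\<lambda>x. x \<notin> A) ?r = ?LB"
      by (simp_all add: delete_symbols_def) (rule filter_cong; blast)+
    then show "?r \<in> shuffles ?LA ?LB"
      using partition_in_shuffles[of ?r "\<lambda>x. x \<in> A"] by simp
  qed
  have "card (?D ` ?X) \<le> 4 ^ w"
  proof (cases "?X = {}")
    case False
    then obtain \<sigma> where s: "\<sigma> \<in> perm_fibre S A L" "\<sigma> \<in> perm_fibre S B M" by blast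
    have d: "distinct \<sigma>" "set \<sigma> = S" "distinct L" "distinct M"
      using s by (auto simp: perm_fibre_def permutations_of_set_def delete_symbols_def)
    have "set ?LA = A - B" "set ?LB = B - A"
      using s d assms(2,3) by (auto simp: perm_fibre_def delete_symbols_def)
    then have l: "length ?LA = w" "length ?LB = w" "set ?LA \<inter> set ?LB = {}"
      using d cA cB distinct_card[of ?LA] distinct_card[of ?LB] by auto
    have "card (?D ` ?X) \<le> card (shuffles ?LA ?LB)"
      using inj sub by (intro card_inj_on_le) auto
    also have "\<dots> = (2 * w) choose w"
      using card_disjoint_shuffles[OF l(3)] l by (simp add: mult_2)
    also have "\<dots> \<le> 2 ^ (2 * w)" by (rule binomial_le_pow2)
    finally show ?thesis by (simp add: power_mult)
  qed simp
  then show "real (card (?D ` ?X)) \<le> 4 ^ w"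
    by (metis of_nat_le_iff of_nat_numeral of_nat_power)
qed


section \<open>Counting covers and pairs of deletion sets\<close>

text \<open>Padding each summand with \<open>w choose (w - u)\<close>, which is at least 1, produces
  a Vandermonde sum.\<close>

lemma card_small_subsets_le:
  assumes "finite S"
  shows "card {U. U \<subseteq> S \<and> card U \<le> w} \<le> (card S + w) choose w"
proof -
  have "{U. U \<subseteq> S \<and> card U \<le> w} = (\<Union>u\<le>w. {U. U \<subseteq> S \<and> card U = u})" by auto
  then have "card {U. U \<subseteq> S \<and> card U \<le> w} \<le> (\<Sum>u\<le>w. card {U. U \<subseteq> S \<and> card U = u})"
    using card_UN_le[of "{..w}" "\<lambda>u. {U. U \<subseteq> S \<and> card U = u}"] by simp
  also have "\<dots> = (\<Sum>u\<le>w. (card S choose u))"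
    using n_subsets[OF assms] by simp
  also have "\<dots> \<le> (\<Sum>u\<le>w. (card S choose u) * (w choose (w - u)))"
    by (intro sum_mono) (simp add: Suc_leI)
  also have "\<dots> = (card S + w) choose w" by (rule vandermonde)
  finally show ?thesis .
qed

text \<open>The sets \<open>T\<close> below are the vertex covers of the graph whose edges are the pairs ordered
  differently by \<open>\<alpha>\<close> and \<open>\<beta>\<close>. If \<open>T\<close> meets a minimum cover \<open>S0\<close> in \<open>X\<close>, then \<open>T\<close> contains the
  cover formed by \<open>X\<close> and the neighbours of \<open>S0 - X\<close>, which already has at least \<open>k\<close> elements.\<close>

lemma card_covers_le:
  assumes S: "finite S"
    and S0: "S0 \<subseteq> S" "delete_symbols \<alpha> S0 = delete_symbols \<beta> S0" "card S0 = k"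
    and min: "\<And>T. T \<subseteq> S \<Longrightarrow> delete_symbols \<alpha> T = delete_symbols \<beta> T \<Longrightarrow> k \<le> card T"
  shows "card {T. T \<subseteq> S \<and> delete_symbols \<alpha> T = delete_symbols \<beta> T \<and> card T = k + w}
    \<le> 2 ^ k * ((card S + w) choose w)"
proof -
  let ?K = "{T. T \<subseteq> S \<and> delete_symbols \<alpha> T = delete_symbols \<beta> T \<and> card T = k + w}"
  let ?p = "\<lambda>u v xs. filter (\<lambda>x. x = u \<or> x = v) xs"
  \<comment> \<open>A cover that omits \<open>S0 - X\<close> is forced to contain all neighbours of
    that set. Conversely \<open>N X\<close> is a cover, since every edge has an endpoint in
    \<open>S0\<close>.\<close>
  define N where "N X = X \<union> {v. \<exists>u\<in>S0 - X. ?p u v \<alpha> \<noteq> ?p u v \<beta>}" for X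
  \<comment> \<open>The trace on \<open>S0\<close> has at most \<open>2 ^ k\<close> values; as the
    forced part has at least \<open>k\<close> elements, at most \<open>w\<close> others
    remain.\<close>
  let ?f = "\<lambda>T. (T \<inter> S0, T - N (T \<inter> S0))"
  have comm: "?p u v xs = ?p v u xs" for u v and xs :: "'a list"
    by (rule filter_cong) auto
  have cover: "delete_symbols \<alpha> (N X) = delete_symbols \<beta> (N X)" for X
    unfolding delete_symbols_eq_iff_pairs
  proof (intro allI impI)
    fix u v assume uv: "u \<notin> N X" "v \<notin> N X"
    show "?p u v \<alpha> = ?p u v \<beta>"
    proof (cases "u \<in> S0 \<or> v \<in> S0")
      case True
      then show ?thesis using uv comm unfolding N_def by fastforce
    next
      case False
      then show ?thesis using S0(2) unfolding delete_symbols_eq_iff_pairs by blast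
    qed
  qed
  have sub: "N (T \<inter> S0) \<subseteq> T" if "delete_symbols \<alpha> T = delete_symbols \<beta> T" for T
    using that unfolding delete_symbols_eq_iff_pairs N_def by blast
  have "inj_on ?f ?K"
  proof (rule inj_onI)
    fix T T' assume T: "T \<in> ?K" "T' \<in> ?K" "?f T = ?f T'"
    then have "T = N (T \<inter> S0) \<union> (T - N (T \<inter> S0))" "T' = N (T' \<inter> S0) \<union> (T' - N (T' \<inter> S0))"
      using sub by blast+
    then show "T = T'" using T(3) by (metis prod.inject)
  qed
  moreover have "?f ` ?K \<subseteq> Pow S0 \<times> {U. U \<subseteq> S \<and> card U \<le> w}"
  proof (clarify, intro conjI SigmaI)
    fix T assume T: "T \<subseteq> S" "delete_symbols \<alpha> T = delete_symbols \<beta> T" "card T = k + w"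
    show "T \<inter> S0 \<in> Pow S0" by simp
    have "finite T" using T(1) S finite_subset by blast
    have s: "N (T \<inter> S0) \<subseteq> T" using sub T by blast
    then have "k \<le> card (N (T \<inter> S0))" using T cover by (intro min) auto
    moreover have "finite (N (T \<inter> S0))" using s \<open>finite T\<close> finite_subset by blast
    ultimately show "T - N (T \<inter> S0) \<in> {U. U \<subseteq> S \<and> card U \<le> w}"
      using T s by (auto simp: card_Diff_subset)
  qed
  moreover have "finite S0" using S0 S finite_subset by blast
  ultimately have "card ?K \<le> card (Pow S0 \<times> {U. U \<subseteq> S \<and> card U \<le> w})"
    using S by (intro card_inj_on_le) auto
  also have "\<dots> = 2 ^ k * card {U. U \<subseteq> S \<and> card U \<le> w}"
    using S0(3) \<open>finite S0\<close> by (simp add: card_cartesian_product card_Pow)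
  also have "\<dots> \<le> 2 ^ k * ((card S + w) choose w)"
    using card_small_subsets_le[OF S] by (rule mult_left_mono) simp
  finally show ?thesis .
qed

text \<open>The union \<open>T\<close> of \<open>A\<close> and \<open>B\<close> is a cover, because
  both \<alpha> and \<beta> agree with \<sigma> once \<open>T\<close> is deleted. Given
  \<open>T\<close>, the sets \<open>A\<close> and \<open>B\<close> are named by their complements
  \<open>P\<close> and \<open>Q\<close> in \<open>T\<close>, of size \<open>w\<close> each; the
  two-fibre bound then counts \<sigma>.\<close>

lemma card_union_class_le:
  assumes S: "finite S"
    and S0: "S0 \<subseteq> S" "delete_symbols \<alpha> S0 = delete_symbols \<beta> S0" "card S0 = k"
    and min: "\<And>T. T \<subseteq> S \<Longrightarrow> delete_symbols \<alpha> T = delete_symbols \<beta> T \<Longrightarrow> k \<le> card T"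
  shows "real (card {\<sigma> \<in> permutations_of_set S. \<exists>A B. A \<subseteq> S \<and> B \<subseteq> S \<and> card A = k \<and> card B = k \<and>
      card (A \<union> B) = k + w \<and> delete_symbols \<sigma> A = delete_symbols \<alpha> A \<and>
      delete_symbols \<sigma> B = delete_symbols \<beta> B})
    \<le> real (2 ^ k * ((card S + w) choose w) * ((k + w) choose w)\<^sup>2) *
      (4 ^ w * (fact (card S) / fact (card S - (k - w))))" (is "real (card ?F) \<le> _")
proof -
  let ?K = "{T. T \<subseteq> S \<and> delete_symbols \<alpha> T = delete_symbols \<beta> T \<and> card T = k + w}"
  let ?W = "\<lambda>T. {P. P \<subseteq> T \<and> card P = w}"
  let ?I = "SIGMA T:?K. ?W T \<times> ?W T"
  let ?b = "4 ^ w * (fact (card S) / fact (card S - (k - w))) :: real"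
  define G where "G = (\<lambda>(T, P, Q). perm_fibre S (T - P) (delete_symbols \<alpha> (T - P)) \<inter>
    perm_fibre S (T - Q) (delete_symbols \<beta> (T - Q)))"
  \<comment> \<open>The last condition makes \<open>P\<close> and \<open>Q\<close> disjoint, as
    \<open>card_two_fibres_le\<close> requires; it is dropped when \<open>J\<close> is
    counted.\<close>
  define J where "J = {(T, P, Q). T \<in> ?K \<and> P \<in> ?W T \<and> Q \<in> ?W T \<and> card ((T - P) \<union> (T - Q)) = k + w}"
  have finK: "finite ?K" using S by simp
  have finT: "finite T" if "T \<in> ?K" for T using that S finite_subset by blast
  have finW: "finite (?W T \<times> ?W T)" if "T \<in> ?K" for T
    using finT[OF that] by (intro finite_cartesian_product) (rule finite_subset[of _ "Pow T"], blast, simp)+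
  have finI: "finite ?I" using finK finW by (rule finite_SigmaI)
  have sub: "J \<subseteq> ?I" unfolding J_def by blast
  have finJ: "finite J" using sub finI by (rule finite_subset)
  have "card J \<le> card ?I" using finI sub by (rule card_mono)
  also have "\<dots> = (\<Sum>T\<in>?K. card (?W T \<times> ?W T))"
    using finK finW by (intro card_SigmaI) blast+
  also have "\<dots> = (\<Sum>T\<in>?K. ((k + w) choose w)\<^sup>2)"
  proof (rule sum.cong)
    fix T assume T: "T \<in> ?K"
    then have "card T = k + w" by simp
    with n_subsets[OF finT[OF T], of w] show "card (?W T \<times> ?W T) = ((k + w) choose w)\<^sup>2"
      by (simp only: card_cartesian_product power2_eq_square)
  qed simp
  also have "\<dots> = card ?K * ((k + w) choose w)\<^sup>2" by simp
  also have "\<dots> \<le> 2 ^ k * ((card S + w) choose w) * ((k + w) choose w)\<^sup>2"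
    using card_covers_le[OF assms] by (rule mult_right_mono) simp_all
  finally have cardJ: "real (card J) \<le> real (2 ^ k * ((card S + w) choose w) * ((k + w) choose w)\<^sup>2)"
    by (simp only: of_nat_le_iff)
  have "real (card ?F) \<le> real (card J) * ?b"
  proof (rule card_le_card_index_times[OF finJ])
    show "finite (G i)" for i by (cases i) (simp add: G_def)
    show "real (card (G i)) \<le> ?b" if "i \<in> J" for i
    proof -
      obtain T P Q where i: "i = (T, P, Q)" by (cases i)
      have T: "T \<subseteq> S" "card T = k + w" and P: "P \<subseteq> T" "card P = w"
        and Q: "Q \<subseteq> T" "card Q = w" and U: "card ((T - P) \<union> (T - Q)) = k + w"
        using that unfolding i J_def by blast+
      have "finite T" using T(1) S by (rule finite_subset)
      then have "finite P" "finite Q" using P(1) Q(1) by (auto intro: finite_subset)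
      then have "card (T - P) = k" "card (T - Q) = k"
        using T P Q by (simp_all add: card_Diff_subset)
      moreover have "T - P \<subseteq> S" "T - Q \<subseteq> S" using T(1) by auto
      ultimately show ?thesis
        unfolding i G_def prod.case using U by (intro card_two_fibres_le[OF S])
    qed
    show "?F \<subseteq> (\<Union>i\<in>J. G i)"
    proof
      fix \<sigma> assume "\<sigma> \<in> ?F"
      then obtain A B where \<sigma>: "\<sigma> \<in> permutations_of_set S"
        and AB: "A \<subseteq> S" "B \<subseteq> S" "card A = k" "card B = k" "card (A \<union> B) = k + w"
          "delete_symbols \<sigma> A = delete_symbols \<alpha> A" "delete_symbols \<sigma> B = delete_symbols \<beta> B" by blast
      let ?T = "A \<union> B"
      have fin: "finite A" "finite B" using AB(1,2) S by (auto intro: finite_subset)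
      have "delete_symbols \<sigma> ?T = delete_symbols \<alpha> ?T" "delete_symbols \<sigma> ?T = delete_symbols \<beta> ?T"
        using delete_symbols_mono[OF AB(6), of ?T] delete_symbols_mono[OF AB(7), of ?T] by auto
      then have "?T \<in> ?K" using AB by simp
      moreover have "card (?T - A) = w" "card (?T - B) = w"
        using AB(3-5) card_Diff_subset[OF fin(1), of ?T] card_Diff_subset[OF fin(2), of ?T] by simp_all
      then have "?T - A \<in> ?W ?T" "?T - B \<in> ?W ?T" by blast+
      moreover have TA: "?T - (?T - A) = A" "?T - (?T - B) = B" by auto
      ultimately have "(?T, ?T - A, ?T - B) \<in> J"
        unfolding J_def mem_Collect_eq prod.case TA using AB(5) by blast
      moreover have "\<sigma> \<in> G (?T, ?T - A, ?T - B)"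
        unfolding G_def prod.case TA using \<sigma> AB by (simp add: perm_fibre_def)
      ultimately show "\<sigma> \<in> (\<Union>i\<in>J. G i)" by (rule UN_I)
    qed
  qed
  also have "\<dots> \<le> real (2 ^ k * ((card S + w) choose w) * ((k + w) choose w)\<^sup>2) * ?b"
    using cardJ by (rule mult_right_mono) simp
  finally show ?thesis .
qed

section \<open>Numerical estimates\<close>

text \<open>Each term is at most the total, so two of its three factors can be replaced by the
  total. This lets a sum of cubes of exponential-series terms be bounded by the cube of an
  exponential.\<close>

lemma sum_cubes_le:
  fixes a :: "'a \<Rightarrow> real"
  assumes "finite I" "\<And>i. i \<in> I \<Longrightarrow> 0 \<le> a i"
  shows "(\<Sum>i\<in>I. a i ^ 3) \<le> (\<Sum>i\<in>I. a i) ^ 3"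
proof -
  have "a i ^ 3 \<le> a i * (\<Sum>i\<in>I. a i)\<^sup>2" if "i \<in> I" for i
  proof -
    have "a i \<le> (\<Sum>i\<in>I. a i)" using assms that by (intro member_le_sum) auto
    then have "(a i)\<^sup>2 \<le> (\<Sum>i\<in>I. a i)\<^sup>2" using assms that by (intro power_mono) auto
    then have "a i * (a i)\<^sup>2 \<le> a i * (\<Sum>i\<in>I. a i)\<^sup>2" using assms that by (intro mult_left_mono) auto
    then show ?thesis by (simp add: power2_eq_square power3_eq_cube)
  qed
  then have "(\<Sum>i\<in>I. a i ^ 3) \<le> (\<Sum>i\<in>I. a i * (\<Sum>i\<in>I. a i)\<^sup>2)" by (rule sum_mono)
  also have "\<dots> = (\<Sum>i\<in>I. a i) ^ 3"
    by (simp flip: sum_distrib_right add: power2_eq_square power3_eq_cube)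
  finally show ?thesis .
qed

lemma exp_partial_sum_le:
  assumes "0 \<le> (y :: real)"
  shows "(\<Sum>w\<le>k. y ^ w / fact w) \<le> exp y"
proof -
  have "(\<lambda>w. y ^ w / fact w) sums exp y"
    using exp_converges[of y] by (simp add: field_simps)
  then show ?thesis
    using assms sum_le_suminf[of "\<lambda>w. y ^ w / fact w" "{..k}"] by (auto simp: sums_iff)
qed

lemma binomial_le_power_div_fact:
  "real (n choose w) \<le> real n ^ w / fact w"
proof -
  have "real ((n choose w) * fact w) \<le> real (n ^ w)"
    using binomial_fact_pow[of n w] by (simp only: of_nat_le_iff)
  then show ?thesis by (simp add: pos_le_divide_eq)
qed

lemma fact_add_ge:
  "fact m * real m ^ w \<le> fact (m + w)"
proof (induction w)
  case (Suc w)
  have "fact m * real m ^ Suc w = real m * (fact m * real m ^ w)" by simp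
  also have "\<dots> \<le> real (m + Suc w) * fact (m + w)" using Suc by (intro mult_mono) auto
  also have "\<dots> = fact (m + Suc w)" by simp
  finally show ?case .
qed simp

text \<open>The \<open>w\<close> missing insertions contribute \<open>(9 / n) ^ w\<close>, which
  cancels the power of \<open>n\<close> from the choice of cover. The three factorials and
  \<open>k ^ (2 * w)\<close> then assemble into a cube, whence the exponent
  \<open>2/3\<close>.\<close>

lemma class_term_le:
  assumes "w \<le> k" "k \<le> n" "k < 8 * (n - k)"
  shows "real (2 ^ k * ((n + w) choose w) * ((k + w) choose w)\<^sup>2) *
      (4 ^ w * (fact n / fact (n - (k - w))))
    \<le> 2 ^ k * (fact n / fact (n - k)) * ((7 * real k powr (2/3)) ^ w / fact w) ^ 3"
proof -
  define m where "m = n - k"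
  have m: "m > 0" "n \<le> 9 * m" "n - (k - w) = m + w" "n > 0" using assms by (auto simp: m_def)
  have 1: "real ((n + w) choose w) \<le> (2 * real n) ^ w / fact w"
  proof -
    have "real ((n + w) choose w) \<le> real (n + w) ^ w / fact w" by (rule binomial_le_power_div_fact)
    also have "\<dots> \<le> (2 * real n) ^ w / fact w"
      using assms by (intro divide_right_mono power_mono) auto
    finally show ?thesis .
  qed
  have 2: "real ((k + w) choose w) \<le> (2 * real k) ^ w / fact w"
  proof -
    have "real ((k + w) choose w) \<le> real (k + w) ^ w / fact w" by (rule binomial_le_power_div_fact)
    also have "\<dots> \<le> (2 * real k) ^ w / fact w"
      using assms by (intro divide_right_mono power_mono) auto
    finally show ?thesis .
  qed
  have 3: "fact n / fact (n - (k - w)) \<le> fact n / fact m * (9 / real n) ^ w"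
  \<comment> \<open>The hypothesis \<open>k < 8 * (n - k)\<close> enters through
    \<open>n \<le> 9 * m\<close>, that is \<open>1 / m \<le> 9 / n\<close>.\<close>
  proof -
    have "fact n / fact (m + w) \<le> fact n / (fact m * real m ^ w)"
      using m fact_add_ge[of m w] by (intro divide_left_mono) auto
    also have "\<dots> = fact n / fact m * (1 / real m) ^ w" by (simp add: power_divide)
    also have "\<dots> \<le> fact n / fact m * (9 / real n) ^ w"
      using m by (intro mult_left_mono power_mono) (auto simp: field_simps)
    finally show ?thesis by (simp only: m)
  qed
  have cube: "(real k powr (2/3)) ^ 3 = (real k)\<^sup>2"
    by (cases "k = 0") (simp_all add: powr_powr flip: powr_realpow powr_numeral)
  have "real (2 ^ k * ((n + w) choose w) * ((k + w) choose w)\<^sup>2) *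
      (4 ^ w * (fact n / fact (n - (k - w))))
    = 2 ^ k * real ((n + w) choose w) * (real ((k + w) choose w))\<^sup>2 *
      (4 ^ w * (fact n / fact (n - (k - w))))" by simp
  also have "\<dots> \<le> 2 ^ k * ((2 * real n) ^ w / fact w) * ((2 * real k) ^ w / fact w)\<^sup>2 *
      (4 ^ w * (fact n / fact m * (9 / real n) ^ w))"
    using 1 2 3 by (intro mult_mono power_mono) auto
  also have "\<dots> = 2 ^ k * (fact n / fact m) *
      ((2 * real n) ^ w * ((2 * real k) ^ w)\<^sup>2 * 4 ^ w * (9 / real n) ^ w) / fact w ^ 3"
    by (simp add: power2_eq_square power3_eq_cube ac_simps)
  also have "(2 * real n) ^ w * ((2 * real k) ^ w)\<^sup>2 * 4 ^ w * (9 / real n) ^ w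
    = ((2 * real n) * (2 * real k)\<^sup>2 * 4 * (9 / real n)) ^ w"
    by (simp only: power2_eq_square power_mult_distrib)
  also have "(2 * real n) * (2 * real k)\<^sup>2 * 4 * (9 / real n) = 288 * (real k)\<^sup>2"
    using m by (simp add: field_simps)
  \<comment> \<open>The constant 288 is rounded up to \<open>343 = 7 ^ 3\<close> to have an integer
    cube root.\<close>
  also have "2 ^ k * (fact n / fact m) * (288 * (real k)\<^sup>2) ^ w / fact w ^ 3
    \<le> 2 ^ k * (fact n / fact m) * (343 * (real k)\<^sup>2) ^ w / fact w ^ 3"
    by (intro divide_right_mono mult_left_mono power_mono) auto
  also have "343 * (real k)\<^sup>2 = (7 * real k powr (2/3)) ^ 3"
    by (simp add: power_mult_distrib cube)
  also have "((7 * real k powr (2/3)) ^ 3) ^ w = ((7 * real k powr (2/3)) ^ w) ^ 3"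
    unfolding power_mult[symmetric] by (simp only: mult.commute)
  finally show ?thesis
    by (simp only: m_def power_divide times_divide_eq_right)
qed

text \<open>One term of the expansion of \<open>(1/8 + 1) ^ (k + m)\<close> bounds the coefficient
  by \<open>9 ^ m * (9/8) ^ k\<close>. Here 9 is below \<open>2 ^ 4\<close> and 9/8 below the square
  root of 2; squaring avoids half-integer exponents.\<close>

lemma binomial_le_two_power:
  assumes "8 * m \<le> k"
  shows "real ((k + m) choose m) \<le> 2 ^ k"
proof -
  let ?b = "real ((k + m) choose m)"
  have "?b * (1/8) ^ m \<le> (\<Sum>i\<le>k + m. real ((k + m) choose i) * (1/8) ^ i)"
    by (rule member_le_sum[where f = "\<lambda>i. real ((k + m) choose i) * (1/8) ^ i"]) auto
  also have "\<dots> = (1/8 + 1) ^ (k + m)" using binomial_ring[of "1/8 :: real" 1 "k + m"] by simp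
  finally have "?b \<le> 9 ^ m * (9/8) ^ k" by (simp add: power_add field_simps)
  then have "?b\<^sup>2 \<le> (9 ^ m * (9/8) ^ k)\<^sup>2" by (intro power_mono) auto
  also have "\<dots> = 81 ^ m * (81/64) ^ k"
    by (simp add: power_mult_distrib power_divide flip: power_mult add: mult.commute[of _ 2])
       (simp add: power_mult)
  also have "\<dots> \<le> 256 ^ m * 2 ^ k" by (intro mult_mono power_mono) auto
  also have "256 ^ m = (2::real) ^ (8 * m)" by (simp add: power_mult)
  also have "(2::real) ^ (8 * m) * 2 ^ k \<le> 2 ^ k * 2 ^ k"
    using assms by (intro mult_right_mono power_increasing) auto
  finally have "?b\<^sup>2 \<le> (2 ^ k)\<^sup>2" by (simp add: power2_eq_square)
  then show ?thesis by (rule power2_le_imp_le) simp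
qed

section \<open>The upper bound\<close>

lemma card_ulam_ball_le:
  assumes S: "finite S"
  shows "real (card {\<sigma> \<in> permutations_of_set S.
      \<exists>A\<subseteq>S. card A = k \<and> delete_symbols \<sigma> A = delete_symbols \<alpha> A})
    \<le> real (card S choose k) * (fact (card S) / fact (card S - k))" (is "real (card ?F) \<le> _")
proof -
  let ?K = "{A. A \<subseteq> S \<and> card A = k}"
  let ?G = "\<lambda>A. perm_fibre S A (delete_symbols \<alpha> A)"
  have "real (card ?F) \<le> real (card ?K) * (fact (card S) / fact (card S - k))"
  proof (rule card_le_card_index_times)
    show "?F \<subseteq> (\<Union>A\<in>?K. ?G A)" by (auto simp: perm_fibre_def)
    fix A assume "A \<in> ?K"
    then show "real (card (?G A)) \<le> fact (card S) / fact (card S - k)"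
      using card_perm_fibre_le_real[OF S, of A "delete_symbols \<alpha> A"] by simp
  qed (use S in auto)
  then show ?thesis using n_subsets[OF S, of k] by simp
qed

text \<open>Since e is at most \<open>4 = 2 ^ 2\<close>, the factor \<open>exp (21 * z)\<close>
  costs at most \<open>42 * z\<close> in the exponent of 2. This is the source of the constant
  42.\<close>

lemma powr_bound_absorbs_exp:
  assumes "0 \<le> (z::real)"
  shows "2 ^ k * exp (7 * z) ^ 3 \<le> 2 powr (real k + 42 * z)"
proof -
  have "exp (7 * z) ^ 3 = exp 1 powr (21 * z)" by (simp add: powr_def flip: exp_of_nat_mult)
  also have "\<dots> \<le> 4 powr (21 * z)"
    using assms exp_le by (intro powr_mono2) auto
  also have "\<dots> = 2 powr (42 * z)"
    by (simp add: powr_powr[of 2 2, simplified] flip: powr_powr)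
  finally show ?thesis by (simp add: powr_add powr_realpow)
qed

lemma card_family_with_diameter_le:
  assumes k: "k \<le> n" and F: "F \<subseteq> perm_strings n" "\<alpha> \<in> F" "\<beta> \<in> F"
    and dist: "ulam_dist n \<alpha> \<beta> = k" "\<And>\<sigma> \<tau>. \<sigma> \<in> F \<Longrightarrow> \<tau> \<in> F \<Longrightarrow> ulam_dist n \<sigma> \<tau> \<le> k"
  shows "real (card F) \<le> fact n / fact (n - k) * 2 powr (real k + 42 * real k powr (2/3))"
proof -
  let ?S = "{1..n}"
  let ?z = "real k powr (2/3)"
  have close: "\<exists>A\<subseteq>?S. card A = k \<and> delete_symbols \<sigma> A = delete_symbols \<tau> A"
    if "\<sigma> \<in> F" "\<tau> \<in> F" for \<sigma> \<tau>
  proof -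
    have "\<sigma> \<in> perm_strings n" "\<tau> \<in> perm_strings n" using that F(1) by auto
    from ulam_dist_attained[OF this] obtain A
      where A: "A \<subseteq> ?S" "delete_symbols \<sigma> A = delete_symbols \<tau> A" "card A = ulam_dist n \<sigma> \<tau>"
      by (elim exE conjE)
    have "card A \<le> k" using dist(2)[OF that] A(3) by simp
    \<comment> \<open>Enlarging a deletion set preserves equality, so all deletion sets can be given
      size exactly \<open>k\<close>.\<close>
    then obtain B where B: "A \<subseteq> B" "B \<subseteq> ?S" "card B = k"
      using exists_subset_between[of A k ?S, OF _ _ A(1)] k by auto
    show ?thesis
      using B(2,3) delete_symbols_mono[OF A(2) B(1)] by (intro exI[of _ B] conjI)
  qed
  show ?thesis
  proof (cases "k < 8 * (n - k)")
    case False
    have "real (card F) \<le> real (card {\<sigma> \<in> perm_strings n.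
      \<exists>A\<subseteq>?S. card A = k \<and> delete_symbols \<sigma> A = delete_symbols \<alpha> A})"
    proof (intro of_nat_mono card_mono)
      show "F \<subseteq> {\<sigma> \<in> perm_strings n. \<exists>A\<subseteq>?S. card A = k \<and> delete_symbols \<sigma> A = delete_symbols \<alpha> A}"
        using F(1) close[OF _ F(2)] by (intro subsetI CollectI conjI) (rule subsetD)
    qed simp
    also have "\<dots> \<le> real (n choose k) * (fact n / fact (n - k))"
      using card_ulam_ball_le[of ?S k \<alpha>] by (simp only: card_atLeastAtMost diff_Suc_1 finite_atLeastAtMost)
    also have "n choose k = (k + (n - k)) choose (n - k)"
      using binomial_symmetric[OF k] k by simp
    also have "real \<dots> * (fact n / fact (n - k)) \<le> 2 ^ k * (fact n / fact (n - k))"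
      using False by (intro mult_right_mono binomial_le_two_power) auto
    also have "(2::real) ^ k = 2 powr real k" by (simp add: powr_realpow)
    also have "\<dots> * (fact n / fact (n - k)) \<le> 2 powr (real k + 42 * ?z) * (fact n / fact (n - k))"
      by (intro mult_right_mono powr_mono) auto
    finally show ?thesis by (simp only: mult.commute)
  next
    case True
    obtain S0 where S0: "S0 \<subseteq> ?S" "card S0 = k" "delete_symbols \<alpha> S0 = delete_symbols \<beta> S0"
      using close[OF F(2,3)] by (elim exE conjE)
    \<comment> \<open>The exact distance between \<alpha> and \<beta> is what makes
      \<open>S0\<close> a minimum cover.\<close>
    have min: "k \<le> card T" if "T \<subseteq> ?S" "delete_symbols \<alpha> T = delete_symbols \<beta> T" for T
    proof -
      have "finite {card A | A. A \<subseteq> ?S \<and> delete_symbols \<alpha> A = delete_symbols \<beta> A}"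
        by (rule finite_subset[of _ "card ` Pow ?S"]) auto
      then show ?thesis unfolding dist(1)[symmetric] ulam_dist_def using that by (intro Min_le) auto
    qed
    let ?C = "\<lambda>w. {\<sigma> \<in> perm_strings n. \<exists>A B. A \<subseteq> ?S \<and> B \<subseteq> ?S \<and> card A = k \<and> card B = k \<and>
      card (A \<union> B) = k + w \<and> delete_symbols \<sigma> A = delete_symbols \<alpha> A \<and>
      delete_symbols \<sigma> B = delete_symbols \<beta> B}"
    let ?r = "fact n / fact (n - k) :: real"
    let ?a = "\<lambda>w. (7 * ?z) ^ w / fact w"
    have C: "real (card (?C w)) \<le> 2 ^ k * ?r * ?a w ^ 3" if "w \<le> k" for w
    proof -
      have "real (card (?C w)) \<le> real (2 ^ k * ((card ?S + w) choose w) * ((k + w) choose w)\<^sup>2) *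
          (4 ^ w * (fact (card ?S) / fact (card ?S - (k - w))))"
        by (rule card_union_class_le[OF finite_atLeastAtMost S0(1,3,2)]) (rule min)
      also have "card ?S = n" by simp
      also have "real (2 ^ k * ((n + w) choose w) * ((k + w) choose w)\<^sup>2) *
          (4 ^ w * (fact n / fact (n - (k - w)))) \<le> 2 ^ k * ?r * ?a w ^ 3"
        by (rule class_term_le[OF that k True])
      finally show ?thesis .
    qed
    have "F \<subseteq> (\<Union>w\<le>k. ?C w)"
    proof
      fix \<sigma> assume \<sigma>: "\<sigma> \<in> F"
      obtain A where A: "A \<subseteq> ?S" "card A = k" "delete_symbols \<sigma> A = delete_symbols \<alpha> A"
        using close[OF \<sigma> F(2)] by blast
      obtain B where B: "B \<subseteq> ?S" "card B = k" "delete_symbols \<sigma> B = delete_symbols \<beta> B"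
        using close[OF \<sigma> F(3)] by blast
      have "finite B" using finite_subset[OF B(1)] by simp
      then have "card (B - A) \<le> k" "card (A \<union> B) = k + card (B - A)"
        using A B finite_subset[OF A(1)] card_mono[of B "B - A"] card_Un_disjoint[of A "B - A"] by auto
      then show "\<sigma> \<in> (\<Union>w\<le>k. ?C w)"
        using A B \<sigma> F(1) by (intro UN_I[of "card (B - A)"]) blast+
    qed
    then have "card F \<le> card (\<Union>w\<le>k. ?C w)" by (intro card_mono) auto
    also have "\<dots> \<le> (\<Sum>w\<le>k. card (?C w))" by (intro card_UN_le) auto
    finally have "real (card F) \<le> (\<Sum>w\<le>k. real (card (?C w)))"
      unfolding of_nat_sum[symmetric] of_nat_le_iff .
    also have "\<dots> \<le> (\<Sum>w\<le>k. 2 ^ k * ?r * ?a w ^ 3)" using C by (intro sum_mono) auto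
    also have "\<dots> = 2 ^ k * ?r * (\<Sum>w\<le>k. ?a w ^ 3)" by (simp add: sum_distrib_left)
    also have "\<dots> \<le> 2 ^ k * ?r * (\<Sum>w\<le>k. ?a w) ^ 3"
      by (intro mult_left_mono sum_cubes_le) auto
    also have "\<dots> \<le> 2 ^ k * ?r * exp (7 * ?z) ^ 3"
      by (intro mult_left_mono power_mono exp_partial_sum_le sum_nonneg) auto
    also have "\<dots> = ?r * (2 ^ k * exp (7 * ?z) ^ 3)" by simp
    also have "\<dots> \<le> ?r * 2 powr (real k + 42 * ?z)"
      by (intro mult_left_mono powr_bound_absorbs_exp) auto
    finally show ?thesis .
  qed
qed

text \<open>The bound increases with \<open>k\<close>, so it suffices to prove it for the true
  diameter \<open>d\<close> of the family.\<close>

lemma card_ulam_bounded_family_le: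
  assumes "k \<le> n" "F \<in> ulam_bounded_families k n"
  shows "real (card F) \<le> fact n / fact (n - k) * 2 powr (real k + 42 * real k powr (2/3))"
proof (cases "F = {}")
  case False
  have F: "F \<subseteq> perm_strings n" "\<And>\<sigma> \<tau>. \<sigma> \<in> F \<Longrightarrow> \<tau> \<in> F \<Longrightarrow> ulam_dist n \<sigma> \<tau> \<le> k"
    using assms(2) by (auto simp: ulam_bounded_families_def)
  let ?D = "(\<lambda>(\<sigma>, \<tau>). ulam_dist n \<sigma> \<tau>) ` (F \<times> F)"
  define d where "d = Max ?D"
  have "finite F" using finite_subset[OF F(1)] by simp
  then have D: "finite ?D" "?D \<noteq> {}" using False by auto
  then have "d \<in> ?D" unfolding d_def by (rule Max_in)
  then obtain \<alpha> \<beta> where ab: "\<alpha> \<in> F" "\<beta> \<in> F" "ulam_dist n \<alpha> \<beta> = d" by auto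
  have le: "ulam_dist n \<sigma> \<tau> \<le> d" if "\<sigma> \<in> F" "\<tau> \<in> F" for \<sigma> \<tau>
    unfolding d_def using that D by (intro Max_ge) auto
  have dk: "d \<le> k" using ab F(2) by blast
  have "real (card F) \<le> fact n / fact (n - d) * 2 powr (real d + 42 * real d powr (2/3))"
    using card_family_with_diameter_le[OF _ F(1) ab le] dk assms(1) by simp
  also have "\<dots> \<le> fact n / fact (n - k) * 2 powr (real k + 42 * real k powr (2/3))"
  proof (rule mult_mono)
    show "(fact n / fact (n - d) :: real) \<le> fact n / fact (n - k)"
      using dk by (intro divide_left_mono fact_mono) auto
    have "real d powr (2/3) \<le> real k powr (2/3)" using dk by (intro powr_mono2) auto
    then show "2 powr (real d + 42 * real d powr (2/3)) \<le> 2 powr (real k + 42 * real k powr (2/3))"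
      using dk by (intro powr_mono) auto
  qed auto
  finally show ?thesis .
qed simp

section \<open>The lower bound\<close>

lemma card_le_max_ulam_family:
  assumes "F \<in> ulam_bounded_families k n"
  shows "card F \<le> max_ulam_family k n"
proof -
  have "finite (ulam_bounded_families k n)"
    by (rule finite_subset[of _ "Pow (perm_strings n)"]) (auto simp: ulam_bounded_families_def)
  then show ?thesis unfolding max_ulam_family_def using assms by (intro Max_ge) auto
qed

lemma perm_fibre_ulam_bounded:
  assumes "A \<subseteq> {1..n}" "card A = k"
  shows "perm_fibre {1..n} A L \<in> ulam_bounded_families k n"
proof -
  have "ulam_dist n \<sigma> \<tau> \<le> k" if "delete_symbols \<sigma> A = delete_symbols \<tau> A" for \<sigma> \<tau>
  proof -
    have "finite {card A | A. A \<subseteq> {1..n} \<and> delete_symbols \<sigma> A = delete_symbols \<tau> A}"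
      by (rule finite_subset[of _ "card ` Pow {1..n}"]) auto
    then show ?thesis unfolding ulam_dist_def using assms that by (intro Min_le) auto
  qed
  then show ?thesis by (auto simp: ulam_bounded_families_def perm_fibre_def)
qed

text \<open>The fibres over the \<open>(n - k)!\<close> possible strings cover all permutations and
  each is an admissible family, so no exact fibre size is needed.\<close>

lemma max_ulam_family_ge:
  assumes "k \<le> n"
  shows "fact n \<le> fact (n - k) * max_ulam_family k n"
proof -
  let ?S = "{1..n}" and ?A = "{1..k}"
  let ?P = "permutations_of_set (?S - ?A)"
  have c: "card (?S - ?A) = n - k" using assms by (simp add: card_Diff_subset)
  have "perm_strings n \<subseteq> (\<Union>L\<in>?P. perm_fibre ?S ?A L)"
    using delete_symbols_permutations by (fastforce simp: perm_fibre_def)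
  then have "card (perm_strings n) \<le> card (\<Union>L\<in>?P. perm_fibre ?S ?A L)"
    by (intro card_mono) auto
  also have "\<dots> \<le> (\<Sum>L\<in>?P. card (perm_fibre ?S ?A L))" by (intro card_UN_le) simp
  also have "\<dots> \<le> of_nat (card ?P) * max_ulam_family k n"
    using assms by (intro sum_bounded_above card_le_max_ulam_family perm_fibre_ulam_bounded) auto
  finally show ?thesis using c by simp
qed

theorem theorem3:
  "\<exists>C::real. C \<ge> 0 \<and>
     (\<forall>(n::nat) (k::nat). k \<le> n \<longrightarrow>
        (fact n / fact (n - k) :: real) \<le> real (max_ulam_family k n) \<and>
        real (max_ulam_family k n) \<le>
          (fact n / fact (n - k) :: real) * 2 powr (real k + C * real k powr (2 / 3)))"
proof (intro exI[of _ 42] conjI allI impI)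
  fix n k :: nat assume k: "k \<le> n"
  have "real (fact n) \<le> real (fact (n - k) * max_ulam_family k n)"
    using max_ulam_family_ge[OF k] by (simp only: of_nat_le_iff)
  then show "(fact n / fact (n - k) :: real) \<le> real (max_ulam_family k n)"
    by (simp add: pos_divide_le_eq mult.commute)
  show "real (max_ulam_family k n) \<le>
      (fact n / fact (n - k) :: real) * 2 powr (real k + 42 * real k powr (2 / 3))"
    using card_ulam_bounded_family_le[OF k] max_ulam_family_attained[of k n] by metis
qed simp

end
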